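(* Let $S$ be an $\mathrm{Lsc}$-like $\mathrm{Cu}$-semigroup and let $X_S$ be its associated topological space. Then: (i) $X_S$ is second countable if and only if $S$ is countably based. (ii) $X_S$ is countably compact if and only if $S$ has a compact order unit. (iii) $X_S$ is normal if and only if $S$ is normal. (iv) $X_S$ is a metric (i.e. metrizable) space whenever $S$ is countably based and normal. (v) $X_S$ is a compact metric (i.e. metrizable) space whenever $S$ is countably based, has a compact order unit and satisfies (O5).
   Context: Cu-semigroups. In a partially ordered set, $x\ll y$ ($x$ is way-below $y$) means: for every increasing sequence $(z_n)_n$ whose supremum exists and is $\geq y$, there is $n$ with $x\leq z_n$. A $\mathrm{Cu}$-semigroup is a positively ordered (commutative) monoid $S$ (partial order compatible with addition, $0\leq x$ for all $x$) such that: (O1) increasing sequences have suprema; (O2) every element is the supremum of an $\ll$-increasing sequence; (O3) $x'\ll x$ and $y'\ll y$ imply $x'+y'\ll x+y$; (O4) $\sup_n x_n+\sup_n y_n=\sup_n(x_n+y_n)$ for increasing sequences. An element $z$ is compact if $z\ll z$. Write $\infty y=\sup_n ny$. An order unit is an element $u$ with $x\leq\infty u$ for all $x\in S$. $S$ is countably based if it has a countable subset such that every element of $S$ is the supremum of an increasing sequence from the subset. (O5): whenever $x+y\leq z$, $x'\ll x$, $y'\ll y$, there is $c$ with $x'+c\leq z\leq x+c$ and $y'\leq c$. Lsc-like. $S$ is distributively lattice ordered if it is a distributive lattice and $x+y=(x\vee y)+(x\wedge y)$ for all $x,y$; it is complete if suprema of arbitrary subsets exist. If $S$ has a greatest element it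 is denoted $\infty$. A subset $H\subseteq S$ is topological if for any two finite increasing sequences $(x_i)_{i=1}^m,(y_i)_{i=1}^m$ in $H$ one has $\sum_i x_i\leq\sum_i y_i$ iff $x_i\leq y_i$ for every $i$. Let $\downarrow e=\{s\in S: s\leq e\}$. $S$ is $\mathrm{Lsc}$-like if it is a complete distributively lattice ordered $\mathrm{Cu}$-semigroup such that: (C1) for all idempotents $y,z$ (elements with $y+y=y$, $z+z=z$), $y\geq z$ iff $\{x<\infty: x$ maximal idempotent, $x\geq y\}\subseteq\{x<\infty: x$ maximal idempotent, $x\geq z\}$, where "$x<\infty$ maximal idempotent" means maximal among idempotents different from $\infty$; (C2) there is a topological subset of the form $\downarrow e$ such that the finite sums of elements of $\downarrow e$ are sup-dense in $S$ (every element of $S$ is the supremum of an increasing sequence of such sums). The element $e$ in (C2) is then the least order unit of $S$, so it is unique. The space $X_S$. With $e$ the least order unit of the $\mathrm{Lsc}$-like semigroup $S$, $X_S=\{x\in S: x<e \text{ maximal}\}$ (maximal among elements strictly below $e$), with closed subsets exactly $C_y=\{x\in X_S: x\geq y\}$ for $y\leq e$. This is a topology. Normal Cu-semigroup. A $\mathrm{Cu}$-semigroup is inf-semilattice ordered if pairs of elements have infima and $x+(y\wedge z)=(x+y)\wedge(x+z)$ for all $x,y,z$ (every $\mathrm{Lsc}$-like $\mathrm{Cu}$-semigroup is inf-semilattice ordered). An inf-semilattice ordered $\mathrm{Cu}$-semigroup $S$ is normal if there is an order unit $z\in S$ such that, whenever $x+y\geq z$ for some $x,y\in S$, there exist $s,t\in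 S$ with $x+s\geq z$, $y+t\geq z$ and $s\wedge t=0$. *)

theory Defs
  imports "HOL-Analysis.Analysis" "HOL-Library.Lub_Glb"
begin

text \<open>
  A positively ordered monoid is a type of class \<open>ordered_comm_monoid_add\<close> with \<open>0\<close> as least
  element. Properties of the whole semigroup are predicates on \<open>TYPE('a)\<close>. Suprema that need not
  exist are expressed by \<open>isLub UNIV\<close>, that is, least upper bounds in the whole type.
\<close>

section \<open>Cu-semigroups\<close>

definition way_below :: "'a::order \<Rightarrow> 'a \<Rightarrow> bool"  (infix \<open>\<lless>\<close> 50) where
  "x \<lless> y \<longleftrightarrow>
     (\<forall>z s. incseq z \<longrightarrow> isLub UNIV (range z) s \<longrightarrow> y \<le> s \<longrightarrow> (\<exists>n::nat. x \<le> z n))"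

definition cu_semigroup :: "'a::ordered_comm_monoid_add itself \<Rightarrow> bool" where
  "cu_semigroup _ \<longleftrightarrow>
     (\<forall>x::'a. 0 \<le> x) \<and>
     \<comment> \<open>(O1)\<close>
     (\<forall>z::nat \<Rightarrow> 'a. incseq z \<longrightarrow> (\<exists>s. isLub UNIV (range z) s)) \<and>
     \<comment> \<open>(O2)\<close>
     (\<forall>x::'a. \<exists>z::nat \<Rightarrow> 'a. (\<forall>n. z n \<lless> z (Suc n)) \<and> isLub UNIV (range z) x) \<and>
     \<comment> \<open>(O3)\<close>
     (\<forall>x' x y' y::'a. x' \<lless> x \<longrightarrow> y' \<lless> y \<longrightarrow> x' + y' \<lless> x + y) \<and>
     \<comment> \<open>(O4)\<close>
     (\<forall>(x::nat \<Rightarrow> 'a) y a b. incseq x \<longrightarrow> incseq y \<longrightarrow>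
        isLub UNIV (range x) a \<longrightarrow> isLub UNIV (range y) b \<longrightarrow>
        isLub UNIV (range (\<lambda>n. x n + y n)) (a + b))"

definition O5 :: "'a::ordered_comm_monoid_add itself \<Rightarrow> bool" where
  "O5 _ \<longleftrightarrow>
     (\<forall>x y z x' y'::'a. x + y \<le> z \<longrightarrow> x' \<lless> x \<longrightarrow> y' \<lless> y \<longrightarrow>
        (\<exists>c. x' + c \<le> z \<and> z \<le> x + c \<and> y' \<le> c))"

definition compact_element :: "'a::order \<Rightarrow> bool" where
  "compact_element z \<longleftrightarrow> z \<lless> z"

text \<open>\<open>\<infinity>y = sup\<^sub>n ny\<close>; the supremum exists in every Cu-semigroup.\<close>

definition infty_times :: "'a::ordered_comm_monoid_add \<Rightarrow> 'a" where
  "infty_times y = (THE s. isLub UNIV (range (\<lambda>n::nat. \<Sum>i<n. y)) s)"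

definition order_unit :: "'a::ordered_comm_monoid_add \<Rightarrow> bool" where
  "order_unit u \<longleftrightarrow> (\<forall>x. x \<le> infty_times u)"

definition sup_dense :: "'a::order set \<Rightarrow> bool" where
  "sup_dense B \<longleftrightarrow>
     (\<forall>x. \<exists>z::nat \<Rightarrow> 'a. incseq z \<and> range z \<subseteq> B \<and> isLub UNIV (range z) x)"

definition countably_based :: "'a::order itself \<Rightarrow> bool" where
  "countably_based _ \<longleftrightarrow> (\<exists>B::'a set. countable B \<and> sup_dense B)"

definition inf_semilattice_ordered ::
    "'a::{ordered_comm_monoid_add, semilattice_inf} itself \<Rightarrow> bool" where
  "inf_semilattice_ordered _ \<longleftrightarrow> (\<forall>x y z::'a. x + inf y z = inf (x + y) (x + z))"

definition normal_cu_semigroup ::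
    "'a::{ordered_comm_monoid_add, semilattice_inf} itself \<Rightarrow> bool" where
  "normal_cu_semigroup _ \<longleftrightarrow>
     cu_semigroup TYPE('a) \<and> inf_semilattice_ordered TYPE('a) \<and>
     (\<exists>z::'a. order_unit z \<and>
        (\<forall>x y. z \<le> x + y \<longrightarrow> (\<exists>s t. z \<le> x + s \<and> z \<le> y + t \<and> inf s t = 0)))"

section \<open>Lsc-like Cu-semigroups\<close>

text \<open>
  In the following, the lattice structure, its completeness and its distributivity are carried by
  the sort; the greatest element \<open>\<infinity>\<close> is \<open>top\<close>. (The class \<open>distrib_lattice\<close> is only finite
  distributivity.)
\<close>

definition distributively_lattice_ordered ::
    "'a::{ordered_comm_monoid_add, distrib_lattice} itself \<Rightarrow> bool" where
  "distributively_lattice_ordered _ \<longleftrightarrow> (\<forall>x y::'a. x + y = sup x y + inf x y)"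

definition idempotent :: "'a::ordered_comm_monoid_add \<Rightarrow> bool" where
  "idempotent y \<longleftrightarrow> y + y = y"

definition maximal_idempotent :: "'a::{ordered_comm_monoid_add, order_top} \<Rightarrow> bool" where
  "maximal_idempotent x \<longleftrightarrow>
     idempotent x \<and> x \<noteq> top \<and> (\<forall>w. idempotent w \<longrightarrow> w \<noteq> top \<longrightarrow> x \<le> w \<longrightarrow> w = x)"

definition topological_subset :: "'a::ordered_comm_monoid_add set \<Rightarrow> bool" where
  "topological_subset H \<longleftrightarrow>
     (\<forall>(m::nat) x y. x ` {1..m} \<subseteq> H \<longrightarrow> y ` {1..m} \<subseteq> H \<longrightarrow>
        mono_on {1..m} x \<longrightarrow> mono_on {1..m} y \<longrightarrow>
        ((\<Sum>i=1..m. x i) \<le> (\<Sum>i=1..m. y i) \<longleftrightarrow> (\<forall>i\<in>{1..m}. x i \<le> y i)))"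

definition C1 :: "'a::{ordered_comm_monoid_add, order_top} itself \<Rightarrow> bool" where
  "C1 _ \<longleftrightarrow>
     (\<forall>y z::'a. idempotent y \<longrightarrow> idempotent z \<longrightarrow>
        (z \<le> y \<longleftrightarrow>
           {x. maximal_idempotent x \<and> y \<le> x} \<subseteq> {x. maximal_idempotent x \<and> z \<le> x}))"

definition C2 :: "'a::ordered_comm_monoid_add itself \<Rightarrow> bool" where
  "C2 _ \<longleftrightarrow>
     (\<exists>e::'a. topological_subset {..e} \<and> sup_dense (sum_list ` lists {..e}))"

definition lsc_like ::
    "'a::{ordered_comm_monoid_add, complete_lattice, distrib_lattice} itself \<Rightarrow> bool" where
  "lsc_like _ \<longleftrightarrow>
     cu_semigroup TYPE('a) \<and> distributively_lattice_ordered TYPE('a) \<and>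
     C1 TYPE('a) \<and> C2 TYPE('a)"

section \<open>The associated space\<close>

definition least_order_unit :: "'a::ordered_comm_monoid_add" where
  "least_order_unit = (LEAST u. order_unit u)"

definition X_points :: "'a::ordered_comm_monoid_add set" where
  "X_points =
     {x. x < least_order_unit \<and> (\<forall>w. w < least_order_unit \<longrightarrow> x \<le> w \<longrightarrow> w = x)}"

definition X_closed :: "'a::ordered_comm_monoid_add \<Rightarrow> 'a set" where
  "X_closed y = {x \<in> X_points. y \<le> x}"

definition X_space :: "'a::ordered_comm_monoid_add topology" where
  "X_space = topology (\<lambda>U. \<exists>y\<le>least_order_unit. U = X_points - X_closed y)"

text \<open>
  The function \<open>topology\<close> is unspecified unless its argument satisfies \<open>istopology\<close>; the lemmas
  below show that \<open>X_space\<close> really has the sets \<open>X_closed y\<close> as its closed sets.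
\<close>

lemma istopology_X_space:
  "istopology (\<lambda>U::'a::{ordered_comm_monoid_add, complete_lattice, distrib_lattice} set.
     \<exists>y\<le>least_order_unit. U = X_points - X_closed y)"
proof -
  let ?e = "least_order_unit :: 'a"
  have prime: "y \<le> x \<or> z \<le> x" if "x \<in> X_points" "inf y z \<le> x" "y \<le> ?e" "z \<le> ?e" for x y z
  proof (rule ccontr)
    assume "\<not> (y \<le> x \<or> z \<le> x)"
    then have "sup x y \<noteq> x" "sup x z \<noteq> x"
      by (metis sup_ge2)+
    moreover have "x < ?e" and max: "\<And>w. w < ?e \<Longrightarrow> x \<le> w \<Longrightarrow> w = x"
      using that(1) by (auto simp: X_points_def)
    ultimately have "sup x y = ?e" "sup x z = ?e"
      using that(3,4) by (meson le_supI order_le_imp_less_or_eq order_less_imp_le sup_ge1)+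
    then have "?e = sup x (inf y z)"
      by (simp add: sup_inf_distrib1)
    also have "\<dots> = x"
      using that(2) by (simp add: sup_absorb1)
    finally show False
      using \<open>x < ?e\<close> by simp
  qed
  have "\<exists>w\<le>?e. (X_points - X_closed y) \<inter> (X_points - X_closed z) = X_points - X_closed w"
    if "y \<le> ?e" "z \<le> ?e" for y z
    using that prime[of _ y z]
    by (intro exI[of _ "inf y z"]) (auto simp: X_closed_def intro: le_infI1 le_infI2)
  moreover have "\<exists>w\<le>?e. \<Union>K = X_points - X_closed w"
    if K: "\<forall>U\<in>K. \<exists>y\<le>?e. U = X_points - X_closed y" for K
  proof -
    obtain f where f: "\<And>U. U \<in> K \<Longrightarrow> f U \<le> ?e \<and> U = X_points - X_closed (f U)"
      using K by metis
    have "\<Union>K = (\<Union>U\<in>K. X_points - X_closed (f U))"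
      using f by blast
    also have "\<dots> = X_points - X_closed (Sup (f ` K))"
      by (auto simp: X_closed_def SUP_le_iff)
    finally show ?thesis
      using f by (intro exI[of _ "Sup (f ` K)"]) (auto intro: SUP_least)
  qed
  ultimately show ?thesis
    unfolding istopology_def by blast
qed

lemma closedin_X_space:
  "closedin X_space C \<longleftrightarrow>
     (\<exists>y\<le>least_order_unit. C = X_closed y)"
  for C :: "'a::{ordered_comm_monoid_add, complete_lattice, distrib_lattice} set"
proof -
  have X_open: "openin X_space U \<longleftrightarrow> (\<exists>y\<le>least_order_unit. U = X_points - X_closed y)"
    for U :: "'a set"
    unfolding X_space_def by (simp add: topology_inverse'[OF istopology_X_space])
  have sub: "X_closed y \<subseteq> X_points" for y :: 'a
    by (auto simp: X_closed_def)
  have "X_closed least_order_unit = ({} :: 'a set)"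
    by (auto simp: X_closed_def X_points_def)
  then have "openin X_space (X_points :: 'a set)"
    unfolding X_open by (metis Diff_empty order_refl)
  then have top: "topspace X_space = (X_points :: 'a set)"
    unfolding topspace_def X_open by blast
  show ?thesis
    unfolding closedin_def top X_open using sub by blast
qed

lemma topspace_X_space:
  "topspace X_space =
     (X_points :: 'a::{ordered_comm_monoid_add, complete_lattice, distrib_lattice} set)"
proof -
  have "closedin X_space (X_closed bot :: 'a set)"
    unfolding closedin_X_space by (intro exI[of _ bot]) simp
  moreover have "X_closed bot = (X_points :: 'a set)"
    by (simp add: X_closed_def)
  ultimately have "(X_points :: 'a set) \<subseteq> topspace X_space"
    using closedin_subset by metis
  moreover obtain y :: 'a where "topspace X_space = X_closed y"
    using closedin_X_space[of "topspace X_space"] closedin_topspace by blast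
  ultimately show ?thesis
    unfolding X_closed_def by blast
qed

text \<open>Analogue of \<open>countably_compact\<close> for abstract topologies.\<close>

definition countably_compact_space :: "'a topology \<Rightarrow> bool" where
  "countably_compact_space X \<longleftrightarrow>
     (\<forall>\<U>. countable \<U> \<longrightarrow> (\<forall>U\<in>\<U>. openin X U) \<longrightarrow> topspace X \<subseteq> \<Union>\<U> \<longrightarrow>
        (\<exists>\<F>\<subseteq>\<U>. finite \<F> \<and> topspace X \<subseteq> \<Union>\<F>))"

end

theory Submission
  imports Defs
begin

text \<open>
  Let \<open>e\<close> be the element given by (C2). Since \<open>{..e}\<close> is topological, \<open>y \<mapsto> \<infinity>y\<close> identifies the
  elements below \<open>e\<close> with the idempotents, so \<open>e\<close> is the least order unit and (C1) says that
  \<open>y \<mapsto> {p. \<not> y \<le> p}\<close> is an isomorphism from \<open>{..e}\<close> onto the open sets of the space of points.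
  A finite sum of elements below \<open>e\<close> can be rearranged into the sum of a chain by replacing
  \<open>a + b\<close> with \<open>(a \<and> b) + (a \<or> b)\<close>; hence such sums are compared through the functions counting, at
  each point, the summands that do not lie below it. This gives \<open>x + (y \<and> z) = (x + y) \<and> (x + z)\<close>,
  first for finite sums and then everywhere by density. With these facts all properties of the
  semigroup become properties of the lattice of open sets: a compact order unit exists iff \<open>e\<close> is
  compact, normality can be tested on pairs with \<open>y \<or> z = e\<close>, and (O5) at a compact \<open>e\<close> produces
  complements that yield normality. Metrizability then is Urysohn's metrization theorem.
\<close>

section \<open>Metrization\<close>

text \<open>The functions \<open>f i\<close> are the coordinates of a map \<open>g\<close> into a
  countable power of the real line. Separation together with T1 makes \<open>g\<close> injective,
  and separation alone makes it open onto its image, so \<open>X\<close> embeds in a metrizable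
  product.\<close>

lemma metrizable_space_countable_separation:
  fixes X :: "'a topology" and f :: "'i \<Rightarrow> 'a \<Rightarrow> real"
  assumes "countable I" and "t1_space X"
    and cont: "\<And>i. i \<in> I \<Longrightarrow> continuous_map X euclideanreal (f i)"
    and sep: "\<And>U x. openin X U \<Longrightarrow> x \<in> U \<Longrightarrow>
      \<exists>i\<in>I. f i x = 0 \<and> (\<forall>y\<in>topspace X - U. f i y = 1)"
  shows "metrizable_space X"
proof -
  let ?P = "product_topology (\<lambda>i. euclideanreal) I"
  define g where "g = (\<lambda>x. \<lambda>i\<in>I. f i x)"
  let ?S = "subtopology ?P (g ` topspace X)"
  have contP: "continuous_map X ?P g"
    unfolding g_def continuous_map_componentwise by (auto simp: cont)
  have "inj_on g (topspace X)"
  proof (rule inj_onI, rule ccontr)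
    fix x y assume xy: "x \<in> topspace X" "y \<in> topspace X" "g x = g y" "x \<noteq> y"
    then obtain U where "openin X U" "x \<in> U" "y \<notin> U"
      using \<open>t1_space X\<close> unfolding t1_space_def by blast
    then obtain i where "i \<in> I" "f i x = 0" "f i y = 1"
      using sep xy by blast
    moreover have "g x i = g y i"
      using xy by simp
    ultimately show False
      by (simp add: g_def)
  qed
  moreover have "openin ?S (g ` U)" if U: "openin X U" for U
  proof (subst openin_subopen, safe)
    fix x assume "x \<in> U"
    then obtain i where i: "i \<in> I" "f i x = 0" "\<forall>y\<in>topspace X - U. f i y = 1"
      using sep[OF U] by blast
    let ?W = "{h \<in> topspace ?P. h i \<in> {..<1}}"
    have "openin ?P ?W"
      by (rule openin_continuous_map_preimage[OF continuous_map_product_projection[OF i(1)]]) auto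
    moreover have "g x \<in> ?W \<inter> g ` topspace X"
      using i \<open>x \<in> U\<close> openin_subset[OF U] by (auto simp: g_def)
    moreover have "?W \<inter> g ` topspace X \<subseteq> g ` U"
      using i by (force simp: g_def)
    ultimately show "\<exists>T. openin ?S T \<and> g x \<in> T \<and> T \<subseteq> g ` U"
      by (meson openin_subtopology_Int)
  qed
  moreover have "topspace ?S = g ` topspace X"
    using continuous_map_image_subset_topspace[OF contP] by auto
  moreover have "continuous_map X ?S g"
    using contP by (auto simp: continuous_map_in_subtopology)
  ultimately have "homeomorphic_map X ?S g"
    by (intro bijective_open_imp_homeomorphic_map) (auto simp: open_map_def)
  moreover have "countable {i \<in> I. \<not> (\<exists>a. topspace euclideanreal \<subseteq> {a})}"
    by (rule countable_subset[OF _ \<open>countable I\<close>]) auto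
  then have "metrizable_space ?P"
    unfolding metrizable_space_product_topology by (simp add: metrizable_space_euclidean)
  ultimately show ?thesis
    using homeomorphic_metrizable_space homeomorphic_map_imp_homeomorphic_space
      metrizable_space_subtopology by blast
qed

text \<open>The index set consists of the pairs of basic open sets with the closure of the first
  inside the second. It is countable, and each pair carries a Urysohn function.\<close>

theorem Urysohn_metrization:
  assumes "second_countable X" "normal_space X" "t1_space X"
  shows "metrizable_space X"
proof -
  obtain B where "countable B" and openB: "\<And>V. V \<in> B \<Longrightarrow> openin X V"
    and base: "\<And>U x. openin X U \<Longrightarrow> x \<in> U \<Longrightarrow> \<exists>V\<in>B. x \<in> V \<and> V \<subseteq> U"
    using assms(1) unfolding second_countable_def by metis
  define I where "I = {(V, W). V \<in> B \<and> W \<in> B \<and> X closure_of V \<subseteq> W}"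
  have "\<exists>f. continuous_map X euclideanreal f \<and> f ` (X closure_of fst i) \<subseteq> {0} \<and>
      f ` (topspace X - snd i) \<subseteq> {1}" if "i \<in> I" for i
  proof -
    have "disjnt (X closure_of fst i) (topspace X - snd i)" "closedin X (topspace X - snd i)"
      using that openB by (auto simp: I_def disjnt_iff)
    then show ?thesis
      using Urysohn_lemma_alt[OF assms(2) closedin_closure_of] by metis
  qed
  then obtain f where f: "\<And>i. i \<in> I \<Longrightarrow> continuous_map X euclideanreal (f i) \<and>
      f i ` (X closure_of fst i) \<subseteq> {0} \<and> f i ` (topspace X - snd i) \<subseteq> {1 :: real}"
    by metis
  show ?thesis
  proof (rule metrizable_space_countable_separation[of I X f])
    show "countable I"
      by (rule countable_subset[of _ "B \<times> B"]) (auto simp: I_def \<open>countable B\<close>)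
    fix U x assume U: "openin X U" "x \<in> U"
    then obtain W where W: "W \<in> B" "x \<in> W" "W \<subseteq> U"
      using base by blast
    \<comment> \<open>Normality applied to the closed singleton inside \<open>W\<close> leaves room
      for a second basic set whose closure stays in \<open>W\<close>; this yields an index in
      \<open>I\<close>.\<close>
    then have "closedin X {x}" "{x} \<subseteq> W"
      using openB openin_subset closedin_t1_singleton[OF assms(3)] by blast+
    then obtain V where V: "openin X V" "{x} \<subseteq> V" "X closure_of V \<subseteq> W"
      using assms(2) openB[OF W(1)] unfolding normal_space_alt by metis
    then obtain V' where V': "V' \<in> B" "x \<in> V'" "V' \<subseteq> V"
      using base by blast
    have "X closure_of V' \<subseteq> W"
      using V V' closure_of_mono by fastforce
    then have "(V', W) \<in> I"
      using V' W by (simp add: I_def)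
    moreover have "x \<in> X closure_of V'"
      by (rule subsetD[OF closure_of_subset[OF openin_subset[OF openB]]]) (use V' in auto)
    ultimately show "\<exists>i\<in>I. f i x = 0 \<and> (\<forall>y\<in>topspace X - U. f i y = 1)"
      using f[of "(V', W)"] W by (intro bexI[of _ "(V', W)"]) auto
  qed (use f assms in auto)
qed

section \<open>The lattice below the least order unit\<close>

lemma isLub_UNIV_iff: "isLub UNIV A s \<longleftrightarrow> s = Sup A"
  for s :: "'a::complete_lattice"
  by (auto simp: isLub_def leastP_def setge_def isUb_def setle_def Sup_upper Sup_least intro: order.antisym)

lemma sum_list_replicate_conv: "sum_list (replicate n y) = (\<Sum>i<n. y)"
  for y :: "'a::comm_monoid_add"
  by (induction n) (auto simp: add.commute)

lemma sorted_wrt_replicate: "sorted_wrt (\<le>) (replicate n (x :: 'a::preorder))"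
  by (induction n) auto

text \<open>Insertion into a sorted list, with comparison and exchange replaced by meet and join:
  the meet is left in place and the join is carried on.\<close>

primrec chain_insert :: "'a::lattice \<Rightarrow> 'a list \<Rightarrow> 'a list" where
  "chain_insert a [] = [a]"
| "chain_insert a (b # bs) = inf a b # chain_insert (sup a b) bs"

lemma length_chain_insert [simp]: "length (chain_insert a bs) = Suc (length bs)"
  by (induction bs arbitrary: a) auto

lemma chain_insert_ge: "l \<le> a \<Longrightarrow> \<forall>b\<in>set bs. l \<le> b \<Longrightarrow> c \<in> set (chain_insert a bs) \<Longrightarrow> l \<le> c"
  by (induction bs arbitrary: a) (auto intro: le_supI1)

lemma chain_insert_le: "a \<le> u \<Longrightarrow> \<forall>b\<in>set bs. b \<le> u \<Longrightarrow> c \<in> set (chain_insert a bs) \<Longrightarrow> c \<le> u"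
proof (induction bs arbitrary: a)
  case (Cons b bs)
  then show ?case
    using Cons.IH[of "sup a b"] by (auto intro: le_infI1)
qed auto

lemma sorted_chain_insert: "sorted_wrt (\<le>) bs \<Longrightarrow> sorted_wrt (\<le>) (chain_insert a bs)"
proof (induction bs arbitrary: a)
  case (Cons b bs)
  have "inf a b \<le> c" if "c \<in> set (chain_insert (sup a b) bs)" for c
  proof (rule chain_insert_ge[OF _ _ that])
    show "\<forall>c\<in>set bs. inf a b \<le> c"
      using Cons.prems by (simp add: le_infI2)
  qed (simp add: le_infI1)
  then show ?case
    using Cons by simp
qed simp

text \<open>The value at \<open>p\<close> of the lower semicontinuous function represented by
  \<open>ys\<close>: each entry contributes the indicator of the open set of points that it does not
  lie below.\<close>

definition count_above :: "'a::order \<Rightarrow> 'a list \<Rightarrow> nat" where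
  "count_above p ys = length (filter (\<lambda>y. \<not> y \<le> p) ys)"

lemma count_above_simps [simp]:
  "count_above p [] = 0"
  "count_above p (y # ys) = (if y \<le> p then 0 else 1) + count_above p ys"
  "count_above p (xs @ ys) = count_above p xs + count_above p ys"
  by (simp_all add: count_above_def)

lemma count_above_le_length: "count_above p ys \<le> length ys"
  by (simp add: count_above_def)

lemma count_above_eq_length:
  assumes "\<forall>y\<in>set ys. x \<le> y" "\<not> x \<le> p"
  shows "count_above p ys = length ys"
  using assms by (induction ys) (auto dest: order_trans)

text \<open>A witness \<open>e\<close> of (C2) is fixed as a parameter; only later is it identified
  with \<open>least_order_unit\<close>.\<close>

locale lsc_like_cu =
  fixes e :: "'a::{ordered_comm_monoid_add, complete_lattice, distrib_lattice}"
  assumes lsc: "lsc_like TYPE('a)"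
    and topological: "topological_subset {..e}"
    and dense: "sup_dense (sum_list ` lists {..e})"
begin

section \<open>Way-below approximation and density of finite sums\<close>

lemma cu: "cu_semigroup TYPE('a)"
  using lsc by (simp add: lsc_like_def)

lemma zero_le: "0 \<le> x" for x :: 'a
  using cu by (simp add: cu_semigroup_def)

lemma add_eq_sup_inf: "x + y = sup x y + inf x y" for x y :: 'a
  using lsc by (simp add: lsc_like_def distributively_lattice_ordered_def)

lemma sup_le_add: "sup x y \<le> x + y" for x y :: 'a
  by (metis add_eq_sup_inf add_mono zero_le order_refl add_0_right)

lemma O2:
  fixes x :: 'a
  obtains z where "\<And>n. z n \<lless> z (Suc n)" "x = (SUP n. z n)"
  using cu unfolding cu_semigroup_def isLub_UNIV_iff by metis

lemma SUP_add:
  fixes x y :: "nat \<Rightarrow> 'a"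
  assumes "incseq x" "incseq y"
  shows "(SUP n. x n) + (SUP n. y n) = (SUP n. x n + y n)"
  using cu assms unfolding cu_semigroup_def isLub_UNIV_iff by simp

lemma way_belowD:
  fixes x y :: 'a
  assumes "x \<lless> y" "incseq z" "y \<le> (SUP n. z n)"
  obtains n where "x \<le> z n"
  using assms unfolding way_below_def isLub_UNIV_iff by blast

lemma way_below_le: "x \<lless> y \<Longrightarrow> x \<le> y" for x y :: 'a
  by (rule way_belowD[of x y "\<lambda>_. y"]) (auto simp: incseq_def)

lemma way_below_mono: "w \<le> x \<Longrightarrow> x \<lless> y \<Longrightarrow> y \<le> z \<Longrightarrow> w \<lless> z" for w x y z :: 'a
  unfolding way_below_def by (meson order_trans)

text \<open>By (O2) every element is a supremum of elements way below it. This reduces inequalities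
  between suprema to inequalities at a single stage.\<close>

lemma le_if_way_below_le:
  fixes x y :: 'a
  assumes "\<And>w. w \<lless> x \<Longrightarrow> w \<le> y"
  shows "x \<le> y"
proof -
  obtain z where z: "\<And>n. z n \<lless> z (Suc n)" "x = (SUP n. z n)"
    using O2[of x] by metis
  then have "z n \<lless> x" for n
    by (metis way_below_mono SUP_upper UNIV_I order_refl)
  then show ?thesis
    using assms z(2) by (auto intro: SUP_least)
qed

lemma dense_below:
  fixes x :: 'a
  obtains z z' where "incseq z" "\<forall>n. set (z' n) \<subseteq> {..e} \<and> z n = sum_list (z' n)" "x = (SUP n. z n)"
proof -
  obtain z where z: "incseq z" "range z \<subseteq> sum_list ` lists {..e}" "x = (SUP n. z n)"
    using dense unfolding sup_dense_def isLub_UNIV_iff by metis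
  then have "\<forall>n. \<exists>ys. set ys \<subseteq> {..e} \<and> z n = sum_list ys"
    by (auto simp: image_subset_iff image_iff lists_eq_set)
  then show thesis
    using that z by metis
qed


lemma le_if_sum_list_le:
  fixes x y :: 'a
  assumes "\<And>ws. set ws \<subseteq> {..e} \<Longrightarrow> sum_list ws \<le> x \<Longrightarrow> sum_list ws \<le> y"
  shows "x \<le> y"
proof -
  obtain z z' where "incseq z"
    and z: "\<forall>n. set (z' n) \<subseteq> {..e} \<and> z n = sum_list (z' n)" "x = (SUP n. z n)"
    by (rule dense_below)
  have "z n \<le> x" for n
    unfolding z(2) by (rule SUP_upper) simp
  then have "z n \<le> y" for n
    using assms z(1) by metis
  then show ?thesis
    using z(2) by (simp add: SUP_le_iff)
qed

lemma member_le_sum_list: "y \<in> set ys \<Longrightarrow> y \<le> sum_list ys" for y :: 'a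
  by (induction ys) (auto simp: zero_le intro: add_increasing add_increasing2)

lemma topological_lists:
  assumes "set xs \<subseteq> {..e}" "set ys \<subseteq> {..e}" "sorted_wrt (\<le>) xs" "sorted_wrt (\<le>) ys"
    and len: "length xs = length ys"
  shows "sum_list xs \<le> sum_list ys \<longleftrightarrow> list_all2 (\<le>) xs ys"
proof -
  \<comment> \<open>Topological subsets are defined with indices from 1, lists are indexed from
    0.\<close>
  let ?f = "\<lambda>zs i. zs ! (i - 1) :: 'a"
  have *: "?f zs ` {1..length zs} \<subseteq> {..e}" "mono_on {1..length zs} (?f zs)"
    "(\<Sum>i=1..length zs. ?f zs i) = sum_list zs"
    if "set zs \<subseteq> {..e}" "sorted_wrt (\<le>) zs" for zs
  proof -
    show "?f zs ` {1..length zs} \<subseteq> {..e}"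
      using that(1) by (auto simp: subset_iff)
    show "mono_on {1..length zs} (?f zs)"
    proof (rule mono_onI)
      fix i j assume "i \<in> {1..length zs}" "j \<in> {1..length zs}" "i \<le> j"
      then show "?f zs i \<le> ?f zs j"
        using sorted_wrt_nth_less[OF that(2), of "i - 1" "j - 1"] by (cases "i = j") auto
    qed
    show "(\<Sum>i=1..length zs. ?f zs i) = sum_list zs"
      by (simp add: sum.atLeast1_atMost_eq sum_list_sum_nth atLeast0LessThan)
  qed
  have "sum_list xs \<le> sum_list ys \<longleftrightarrow> (\<forall>i\<in>{1..length xs}. ?f xs i \<le> ?f ys i)"
    using topological[unfolded topological_subset_def, rule_format, of "?f xs" "length xs" "?f ys"]
      *[OF assms(1,3)] *[OF assms(2,4)] len by simp
  also have "\<dots> \<longleftrightarrow> (\<forall>i<length xs. xs ! i \<le> ys ! i)"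
    unfolding image_Suc_lessThan[symmetric] by auto
  finally show ?thesis
    unfolding list_all2_conv_all_nth using len by blast
qed

text \<open>Padded with zeros in front, \<open>w\<close> becomes a chain as long as the constant
  chain of \<open>y\<close>; comparing the last entries gives the claim.\<close>

lemma le_if_le_replicate:
  assumes "w \<le> e" "y \<le> e" "w \<le> sum_list (replicate n y)"
  shows "w \<le> y"
proof (cases n)
  case 0
  then show ?thesis
    using assms(3) zero_le[of y] by simp
next
  case (Suc m)
  have "sum_list (replicate m 0 @ [w]) = w"
    by (induction m) auto
  moreover have "sorted_wrt (\<le>) (replicate m 0 @ [w])" "set (replicate m 0 @ [w]) \<subseteq> {..e}"
    using assms(1) zero_le by (auto simp: sorted_wrt_append sorted_wrt_replicate)
  ultimately have "list_all2 (\<le>) (replicate m 0 @ [w]) (replicate n y)"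
    using assms Suc topological_lists[of "replicate m 0 @ [w]" "replicate n y"]
    by (auto simp: sorted_wrt_replicate simp del: replicate_Suc)
  then have "list_all2 (\<le>) (replicate m 0 @ [w]) (replicate m y @ [y])"
    using Suc by (simp add: replicate_append_same)
  then show ?thesis
    by (simp add: list_all2_append)
qed

subsection \<open>Infinite multiples\<close>

lemma infty_times_eq: "infty_times y = (SUP n. sum_list (replicate n y))" for y :: 'a
  unfolding infty_times_def isLub_UNIV_iff by (simp add: sum_list_replicate_conv)

lemma incseq_replicate: "incseq (\<lambda>n. sum_list (replicate n y))" for y :: 'a
  by (rule incseq_SucI) (simp add: zero_le add_increasing)

lemma le_infty_times: "y \<le> infty_times y" for y :: 'a
  unfolding infty_times_eq by (rule SUP_upper2[of 1]) auto

text \<open>By (O4) the double is the supremum of the even multiples of \<open>y\<close>.\<close>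

lemma idempotent_infty_times: "idempotent (infty_times y)" for y :: 'a
proof -
  have "infty_times y + infty_times y = (SUP n. sum_list (replicate n y) + sum_list (replicate n y))"
    unfolding infty_times_eq by (rule SUP_add) (rule incseq_replicate)+
  also have "\<dots> \<le> infty_times y"
    unfolding infty_times_eq
    by (rule SUP_least, rule SUP_upper2[of "_ + _"]) (auto simp: replicate_add)
  finally show ?thesis
    unfolding idempotent_def
    by (intro order.antisym) (auto simp: zero_le add_increasing)
qed

lemma sum_list_le_idempotent:
  fixes w :: 'a
  assumes "idempotent w"
  shows "(\<And>y. y \<in> set ys \<Longrightarrow> y \<le> w) \<Longrightarrow> sum_list ys \<le> w"
proof (induction ys)
  case (Cons y ys)
  then have "y + sum_list ys \<le> w + w"
    by (intro add_mono) auto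
  then show ?case
    using assms by (simp add: idempotent_def)
qed (simp add: zero_le)

lemma infty_times_le: "idempotent w \<Longrightarrow> y \<le> w \<Longrightarrow> infty_times y \<le> w" for w y :: 'a
  unfolding infty_times_eq by (auto intro!: SUP_least sum_list_le_idempotent)

lemma infty_times_mono: "x \<le> y \<Longrightarrow> infty_times x \<le> infty_times y" for x y :: 'a
  by (meson idempotent_infty_times infty_times_le le_infty_times order_trans)

text \<open>Anything way below \<open>w\<close> already lies under a finite multiple of
  \<open>y\<close>, where the multiple can be cancelled. Hence \<open>infty_times\<close> is an
  order embedding on \<open>{..e}\<close>.\<close>

lemma le_if_le_infty_times:
  assumes "w \<le> e" "y \<le> e" "w \<le> infty_times y"
  shows "w \<le> y"
proof (rule le_if_way_below_le)
  fix v assume "v \<lless> w"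
  then obtain n where "v \<le> sum_list (replicate n y)"
    using assms(3) unfolding infty_times_eq by (rule way_belowD[OF _ incseq_replicate])
  then show "v \<le> y"
    using le_if_le_replicate \<open>v \<lless> w\<close> assms way_below_le order_trans by metis
qed

text \<open>In a finite sum below \<open>x\<close> with summands below \<open>e\<close>, each
  summand lies below \<open>inf x e\<close>, and an idempotent bounds a sum as soon as it bounds the
  summands.\<close>

lemma le_infty_times_inf: "x \<le> infty_times (inf x e)"
proof (rule le_if_sum_list_le)
  fix ws assume ws: "set ws \<subseteq> {..e}" "sum_list ws \<le> x"
  show "sum_list ws \<le> infty_times (inf x e)"
  proof (rule sum_list_le_idempotent[OF idempotent_infty_times])
    fix y assume "y \<in> set ws"
    then have "y \<le> inf x e"
      using ws member_le_sum_list by (auto intro: order_trans)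
    then show "y \<le> infty_times (inf x e)"
      using le_infty_times order_trans by blast
  qed
qed

lemma order_unit_e: "order_unit e"
  unfolding order_unit_def
  by (intro allI order_trans[OF le_infty_times_inf infty_times_mono]) simp

text \<open>The part of \<open>u\<close> below \<open>e\<close> generates the same idempotent as
  \<open>u\<close>, and cancelling the infinite multiple shows that this part is all of
  \<open>e\<close>.\<close>

lemma e_le_order_unit:
  assumes "order_unit u"
  shows "e \<le> u"
proof -
  have "e \<le> infty_times u"
    using assms by (simp add: order_unit_def)
  also have "\<dots> \<le> infty_times (inf u e)"
    by (rule infty_times_le[OF idempotent_infty_times le_infty_times_inf])
  finally have "e \<le> inf u e"
    by (rule le_if_le_infty_times[rotated 2]) auto
  then show ?thesis
    by simp
qed

lemma least_order_unit_eq: "least_order_unit = e"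
  unfolding least_order_unit_def by (intro Least_equality order_unit_e e_le_order_unit)

subsection \<open>Points\<close>

lemma X_pointsD:
  assumes "p \<in> X_points"
  shows "p < e" "\<And>w. w < e \<Longrightarrow> p \<le> w \<Longrightarrow> w = p"
  using assms by (auto simp: X_points_def least_order_unit_eq)

text \<open>Points are meet-prime in \<open>{..e}\<close>: by maximality \<open>p\<close> joins to
  \<open>e\<close> with anything below \<open>e\<close> that is not below \<open>p\<close>, and
  distributivity carries this over to meets.\<close>

lemma inf_le_point_iff:
  assumes "p \<in> X_points" "y \<le> e" "z \<le> e"
  shows "inf y z \<le> p \<longleftrightarrow> y \<le> p \<or> z \<le> p"
proof
  have *: "sup p w = e" if "w \<le> e" "\<not> w \<le> p" for w
  proof (rule ccontr)
    assume "sup p w \<noteq> e"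
    then have "sup p w < e"
      using X_pointsD(1)[OF assms(1)] that(1) by (simp add: order_less_le)
    then have "sup p w = p"
      by (rule X_pointsD(2)[OF assms(1)]) simp
    then show False
      using that(2) by (metis sup.cobounded2)
  qed
  assume "inf y z \<le> p"
  then have "sup p (inf y z) = p"
    by (rule sup_absorb1)
  show "y \<le> p \<or> z \<le> p"
  proof (rule ccontr)
    assume "\<not> (y \<le> p \<or> z \<le> p)"
    then have "sup p (inf y z) = e"
      using *[OF assms(2)] *[OF assms(3)] by (simp add: sup_inf_distrib1)
    then show False
      using \<open>sup p (inf y z) = p\<close> X_pointsD(1)[OF assms(1)] by simp
  qed
next
  assume "y \<le> p \<or> z \<le> p"
  then show "inf y z \<le> p"
    using le_infI1 le_infI2 by metis
qed

text \<open>There are enough points to determine the order on \<open>{..e}\<close>. A maximal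
  idempotent \<open>x\<close> yields the point \<open>inf x e\<close>, so (C1) applies to the
  infinite multiples of \<open>y\<close> and \<open>z\<close>, which can then be cancelled.\<close>

lemma le_if_points:
  assumes "y \<le> e" "z \<le> e" and points: "\<And>p. p \<in> X_points \<Longrightarrow> y \<le> p \<Longrightarrow> z \<le> p"
  shows "z \<le> y"
proof -
  have e_top: "x = top" if "idempotent x" "e \<le> x" for x :: 'a
    using infty_times_le[OF that] order_unit_e unfolding order_unit_def
    by (metis order_trans top.extremum_uniqueI)
  have "infty_times z \<le> x" if x: "maximal_idempotent x" "infty_times y \<le> x" for x
  proof -
    have idem: "idempotent x" and "x \<noteq> top"
      and max: "\<And>w. idempotent w \<Longrightarrow> w \<noteq> top \<Longrightarrow> x \<le> w \<Longrightarrow> w = x"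
      using x(1) by (auto simp: maximal_idempotent_def)
    have "inf x e < e"
      using e_top[OF idem] \<open>x \<noteq> top\<close> by (metis inf.absorb_iff2 inf.cobounded2 order_le_less)
    \<comment> \<open>For maximality, the idempotent generated by \<open>w\<close> contains
      \<open>x\<close>, and it is not \<open>top\<close> because \<open>w < e\<close>; hence it
      equals \<open>x\<close>, so \<open>w\<close> is below \<open>x\<close>.\<close>
    moreover have "w = inf x e" if w: "w < e" "inf x e \<le> w" for w
    proof -
      have "infty_times w \<noteq> top"
        using le_if_le_infty_times[of e w] w(1) by fastforce
      moreover have "x \<le> infty_times w"
        using le_infty_times_inf infty_times_mono[OF w(2)] order_trans by blast
      ultimately have "infty_times w = x"
        using max idempotent_infty_times by blast
      then show ?thesis
        using w le_infty_times[of w] by (intro order.antisym) auto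
    qed
    ultimately have "inf x e \<in> X_points"
      by (auto simp: X_points_def least_order_unit_eq)
    moreover have "y \<le> inf x e"
      using le_infty_times[of y] x(2) assms(1) by (auto intro: order_trans)
    ultimately have "z \<le> x"
      using points by (meson le_inf_iff)
    then show ?thesis
      by (rule infty_times_le[OF idem])
  qed
  then have "infty_times z \<le> infty_times y"
    using lsc idempotent_infty_times[of y] idempotent_infty_times[of z]
    by (auto simp: lsc_like_def C1_def)
  then show ?thesis
    by (rule le_if_le_infty_times[OF assms(2,1) order_trans[OF le_infty_times]])
qed

subsection \<open>Finite sums as counting functions\<close>

lemma sum_list_chain_insert: "sum_list (chain_insert a bs) = a + sum_list bs" for a :: 'a
proof (induction bs arbitrary: a)
  case (Cons b bs)
  have "inf a b + (sup a b + sum_list bs) = (sup a b + inf a b) + sum_list bs"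
    by (simp add: ac_simps)
  also have "\<dots> = a + (b + sum_list bs)"
    unfolding add_eq_sup_inf[symmetric] by (rule add.assoc)
  finally show ?case
    using Cons.IH by simp
qed simp

text \<open>At a point, \<open>sup a b\<close> counts when one of \<open>a\<close>, \<open>b\<close>
  does and, by primeness, \<open>inf a b\<close> counts when both do, so each exchange preserves the
  count.\<close>

lemma count_above_chain_insert:
  assumes "p \<in> X_points"
  shows "a \<le> e \<Longrightarrow> set bs \<subseteq> {..e} \<Longrightarrow>
    count_above p (chain_insert a bs) = count_above p (a # bs)"
proof (induction bs arbitrary: a)
  case (Cons b bs)
  then have "inf a b \<le> p \<longleftrightarrow> a \<le> p \<or> b \<le> p"
    by (intro inf_le_point_iff[OF assms]) auto
  moreover have "count_above p (chain_insert (sup a b) bs) = count_above p (sup a b # bs)"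
    using Cons.prems by (intro Cons.IH) auto
  ultimately show ?case
    by auto
qed simp

text \<open>This is insertion sort with \<open>chain_insert\<close>, which preserves both the sum
  and the counts.\<close>

lemma chain_rearrangement:
  "set ys \<subseteq> {..e} \<Longrightarrow>
    \<exists>zs. set zs \<subseteq> {..e} \<and> sorted_wrt (\<le>) zs \<and> length zs = length ys \<and> sum_list zs = sum_list ys \<and>
      (\<forall>p\<in>X_points. count_above p zs = count_above p ys)"
proof (induction ys)
  case (Cons a ys)
  then have a: "a \<le> e"
    by simp
  obtain zs where zs: "set zs \<subseteq> {..e}" "sorted_wrt (\<le>) zs" "length zs = length ys"
    "sum_list zs = sum_list ys" "\<forall>p\<in>X_points. count_above p zs = count_above p ys"
    using Cons by auto
  show ?case
  proof (intro exI conjI)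
    show "set (chain_insert a zs) \<subseteq> {..e}"
      using a zs(1) chain_insert_le[of a e zs] by fastforce
    show "\<forall>p\<in>X_points. count_above p (chain_insert a zs) = count_above p (a # ys)"
      using count_above_chain_insert[OF _ a zs(1)] zs(5) by simp
    show "sorted_wrt (\<le>) (chain_insert a zs)"
      by (rule sorted_chain_insert[OF zs(2)])
    show "length (chain_insert a zs) = length (a # ys)"
      using zs(3) by simp
    show "sum_list (chain_insert a zs) = sum_list (a # ys)"
      using zs(4) by (simp add: sum_list_chain_insert)
  qed
qed simp

lemma common_length_chains:
  assumes "set xs \<subseteq> {..e}" "set ys \<subseteq> {..e}"
  obtains xs' ys' where "set xs' \<subseteq> {..e}" "set ys' \<subseteq> {..e}"
    "sorted_wrt (\<le>) xs'" "sorted_wrt (\<le>) ys'" "length xs' = length ys'"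
    "sum_list xs' = sum_list xs" "sum_list ys' = sum_list ys"
    "\<forall>p\<in>X_points. count_above p xs' = count_above p xs"
    "\<forall>p\<in>X_points. count_above p ys' = count_above p ys"
proof -
  \<comment> \<open>Zeros in front keep a chain sorted, change neither sum nor counts, and provide
    the equal lengths that the topological condition requires.\<close>
  have pad: "\<exists>zs'. set zs' \<subseteq> {..e} \<and> sorted_wrt (\<le>) zs' \<and> length zs' = m + length zs \<and>
      sum_list zs' = sum_list zs \<and> (\<forall>p\<in>X_points. count_above p zs' = count_above p zs)"
    if zs: "set zs \<subseteq> {..e}" for zs m
  proof -
    obtain zs' where zs': "set zs' \<subseteq> {..e}" "sorted_wrt (\<le>) zs'" "length zs' = length zs"
      "sum_list zs' = sum_list zs" "\<forall>p\<in>X_points. count_above p zs' = count_above p zs"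
      using chain_rearrangement[OF zs] by metis
    have "sum_list (replicate m 0) = (0::'a)" "count_above p (replicate m 0) = 0" for p :: 'a
      by (induction m) (auto simp: zero_le)
    then show ?thesis
      using zs' zero_le
      by (intro exI[of _ "replicate m 0 @ zs'"]) (auto simp: sorted_wrt_append sorted_wrt_replicate)
  qed
  obtain xs' where xs': "set xs' \<subseteq> {..e} \<and> sorted_wrt (\<le>) xs' \<and> length xs' = length ys + length xs \<and>
      sum_list xs' = sum_list xs \<and> (\<forall>p\<in>X_points. count_above p xs' = count_above p xs)"
    using pad[OF assms(1)] by blast
  obtain ys' where ys': "set ys' \<subseteq> {..e} \<and> sorted_wrt (\<le>) ys' \<and> length ys' = length xs + length ys \<and>
      sum_list ys' = sum_list ys \<and> (\<forall>p\<in>X_points. count_above p ys' = count_above p ys)"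
    using pad[OF assms(2)] by blast
  show thesis
    by (rule that[of xs' ys']) (use xs' ys' in auto)
qed

text \<open>Both sums are first written as chains of equal length. In a chain the entries that count
  at \<open>p\<close> form a final segment, so comparing counts at all points amounts to comparing
  entries.\<close>

lemma sum_list_le_iff_count_above:
  assumes "set xs \<subseteq> {..e}" "set ys \<subseteq> {..e}"
  shows "sum_list xs \<le> sum_list ys \<longleftrightarrow> (\<forall>p\<in>X_points. count_above p xs \<le> count_above p ys)"
proof -
  have chains: "list_all2 (\<le>) xs ys \<longleftrightarrow> (\<forall>p\<in>X_points. count_above p xs \<le> count_above p ys)"
    if "length xs = length ys" "set xs \<subseteq> {..e}" "set ys \<subseteq> {..e}"
      "sorted_wrt (\<le>) xs" "sorted_wrt (\<le>) ys" for xs ys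
    using that
  proof (induction rule: list_induct2)
    case (Cons x xs y ys)
    \<comment> \<open>If \<open>x\<close> counts at \<open>p\<close> and \<open>y\<close> does not,
      then the whole first chain counts, which exceeds what \<open>ys\<close> alone can
      supply.\<close>
    have "x \<le> y" if le: "\<forall>p\<in>X_points. count_above p (x # xs) \<le> count_above p (y # ys)"
    proof (rule le_if_points)
      fix p assume p: "p \<in> X_points" "y \<le> p"
      show "x \<le> p"
      proof (rule ccontr)
        assume "\<not> x \<le> p"
        then have "count_above p (x # xs) = Suc (length xs)"
          using Cons.prems count_above_eq_length[of xs x p] by auto
        then show False
          using le p count_above_le_length[of p ys] Cons.hyps by fastforce
      qed
    qed (use Cons.prems in auto)
    \<comment> \<open>If \<open>y\<close> counts at \<open>p\<close>, so does all of
      \<open>ys\<close>, and equal lengths suffice; otherwise the heads contribute nothing to the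
      right-hand side.\<close>
    moreover have "count_above p xs \<le> count_above p ys"
      if le: "count_above p (x # xs) \<le> count_above p (y # ys)" for p
    proof (cases "y \<le> p")
      case False
      then have "count_above p ys = length ys"
        using Cons.prems count_above_eq_length[of ys y p] by auto
      then show ?thesis
        using count_above_le_length[of p xs] Cons.hyps by simp
    qed (use le in \<open>auto split: if_splits\<close>)
    moreover have "count_above p (x # xs) \<le> count_above p (y # ys)"
      if "x \<le> y" "count_above p xs \<le> count_above p ys" for p
      using that by (auto dest: order_trans)
    moreover have "list_all2 (\<le>) xs ys \<longleftrightarrow> (\<forall>p\<in>X_points. count_above p xs \<le> count_above p ys)"
      using Cons.IH Cons.prems by simp
    ultimately show ?case
      unfolding list.rel_inject(2) by blast
  qed simp
  obtain xs' ys' where *: "set xs' \<subseteq> {..e}" "set ys' \<subseteq> {..e}"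
    "sorted_wrt (\<le>) xs'" "sorted_wrt (\<le>) ys'" "length xs' = length ys'"
    "sum_list xs' = sum_list xs" "sum_list ys' = sum_list ys"
    "\<forall>p\<in>X_points. count_above p xs' = count_above p xs"
    "\<forall>p\<in>X_points. count_above p ys' = count_above p ys"
    by (rule common_length_chains[OF assms])
  have "sum_list xs \<le> sum_list ys \<longleftrightarrow> (\<forall>p\<in>X_points. count_above p xs' \<le> count_above p ys')"
    using topological_lists[OF *(1-5)] chains[OF *(5,1-4)] *(6,7) by simp
  also have "\<dots> \<longleftrightarrow> (\<forall>p\<in>X_points. count_above p xs \<le> count_above p ys)"
    using *(8,9) by simp
  finally show ?thesis .
qed

text \<open>Final segments of lists of equal length are nested, and by primeness the entrywise meet
  counts exactly on the shorter one.\<close>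

lemma count_above_map2_inf:
  assumes "length xs = length ys" "set xs \<subseteq> {..e}" "set ys \<subseteq> {..e}"
    "sorted_wrt (\<le>) xs" "sorted_wrt (\<le>) ys" and p: "p \<in> X_points"
  shows "count_above p (map2 inf xs ys) = min (count_above p xs) (count_above p ys)"
  using assms(1-5)
proof (induction rule: list_induct2)
  case (Cons x xs y ys)
  have "count_above p xs = length xs" if "\<not> x \<le> p"
    using that Cons.prems count_above_eq_length[of xs x p] by auto
  moreover have "count_above p ys = length ys" if "\<not> y \<le> p"
    using that Cons.prems count_above_eq_length[of ys y p] by auto
  ultimately show ?case
    using Cons count_above_le_length[of p xs] count_above_le_length[of p ys]
    by (auto simp: inf_le_point_iff[OF p])
qed simp

lemma inf_sum_list:
  assumes "set xs \<subseteq> {..e}" "set ys \<subseteq> {..e}"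
  obtains zs where "set zs \<subseteq> {..e}" "sum_list zs \<le> sum_list xs" "sum_list zs \<le> sum_list ys"
    "\<forall>p\<in>X_points. count_above p zs = min (count_above p xs) (count_above p ys)"
proof -
  obtain xs' ys' where *: "set xs' \<subseteq> {..e}" "set ys' \<subseteq> {..e}"
    "sorted_wrt (\<le>) xs'" "sorted_wrt (\<le>) ys'" "length xs' = length ys'"
    "sum_list xs' = sum_list xs" "sum_list ys' = sum_list ys"
    and c: "\<forall>p\<in>X_points. count_above p xs' = count_above p xs"
      "\<forall>p\<in>X_points. count_above p ys' = count_above p ys"
    by (rule common_length_chains[OF assms])
  let ?zs = "map2 inf xs' ys'"
  have set: "set ?zs \<subseteq> {..e}"
    using *(1) by (auto dest!: set_zip_leftD intro: le_infI1)
  have count: "count_above p ?zs = min (count_above p xs) (count_above p ys)" if "p \<in> X_points" for p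
    using count_above_map2_inf[OF *(5,1-4) that] c that by simp
  then have "sum_list ?zs \<le> sum_list xs" "sum_list ?zs \<le> sum_list ys"
    using set assms by (auto simp: sum_list_le_iff_count_above)
  then show thesis
    using that set count by blast
qed

text \<open>For counts this is the identity \<open>k + min m n = min (k + m) (k + n)\<close>.
  Elements way below the right-hand side reduce the general case to finite sums.\<close>

lemma add_inf_distrib: "x + inf y z = inf (x + y) (x + z)" for x y z :: 'a
proof (rule order.antisym)
  show "x + inf y z \<le> inf (x + y) (x + z)"
    by (auto intro: add_left_mono)
  obtain a a' where a: "incseq a" "\<forall>n. set (a' n) \<subseteq> {..e} \<and> a n = sum_list (a' n)" "x = (SUP n. a n)"
    by (rule dense_below)
  obtain b b' where b: "incseq b" "\<forall>n. set (b' n) \<subseteq> {..e} \<and> b n = sum_list (b' n)" "y = (SUP n. b n)"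
    by (rule dense_below)
  obtain c c' where c: "incseq c" "\<forall>n. set (c' n) \<subseteq> {..e} \<and> c n = sum_list (c' n)" "z = (SUP n. c n)"
    by (rule dense_below)
  have inc: "incseq (\<lambda>n. a n + b n)" "incseq (\<lambda>n. a n + c n)"
    using a(1) b(1) c(1) by (auto simp: incseq_def intro: add_mono)
  show "inf (x + y) (x + z) \<le> x + inf y z"
  proof (rule le_if_way_below_le)
    fix w assume w: "w \<lless> inf (x + y) (x + z)"
    obtain m where m: "w \<le> a m + b m"
      using way_belowD[OF w inc(1)] SUP_add[OF a(1) b(1)] a(3) b(3) by auto
    obtain n where n: "w \<le> a n + c n"
      using way_belowD[OF w inc(2)] SUP_add[OF a(1) c(1)] a(3) c(3) by auto
    \<comment> \<open>A common stage is needed so that both bounds use the same approximation of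
      \<open>x\<close>.\<close>
    let ?k = "max m n"
    have k: "w \<le> a ?k + b ?k" "w \<le> a ?k + c ?k"
      using m n incseqD[OF inc(1), of m ?k] incseqD[OF inc(2), of n ?k] by auto
    obtain zs where zs: "set zs \<subseteq> {..e}" "sum_list zs \<le> b ?k" "sum_list zs \<le> c ?k"
      "\<forall>p\<in>X_points. count_above p zs = min (count_above p (b' ?k)) (count_above p (c' ?k))"
      by (rule inf_sum_list[of "b' ?k" "c' ?k"]) (use b(2)[rule_format, of ?k] c(2)[rule_format, of ?k] in auto)
    \<comment> \<open>As \<open>w\<close> may fail to be a finite sum, it is tested on the finite
      sums below it, where counts apply.\<close>
    have "w \<le> a ?k + sum_list zs"
    proof (rule le_if_sum_list_le)
      fix ws assume ws: "set ws \<subseteq> {..e}" "sum_list ws \<le> w"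
      then have "sum_list ws \<le> sum_list (a' ?k @ b' ?k)" "sum_list ws \<le> sum_list (a' ?k @ c' ?k)"
        using k a(2)[rule_format, of ?k] b(2)[rule_format, of ?k] c(2)[rule_format, of ?k] by (auto intro: order_trans)
      moreover have sets: "set (a' ?k @ b' ?k) \<subseteq> {..e}" "set (a' ?k @ c' ?k) \<subseteq> {..e}"
          "set (a' ?k @ zs) \<subseteq> {..e}"
        using zs(1) a(2)[rule_format, of ?k] b(2)[rule_format, of ?k] c(2)[rule_format, of ?k] by simp_all
      ultimately have "\<forall>p\<in>X_points. count_above p ws \<le> count_above p (a' ?k @ b' ?k)"
        "\<forall>p\<in>X_points. count_above p ws \<le> count_above p (a' ?k @ c' ?k)"
        unfolding sum_list_le_iff_count_above[OF ws(1) sets(1)] sum_list_le_iff_count_above[OF ws(1) sets(2)]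
        by blast+
      then have "sum_list ws \<le> sum_list (a' ?k @ zs)"
        unfolding sum_list_le_iff_count_above[OF ws(1) sets(3)] using zs(4) by (simp add: min_def)
      then show "sum_list ws \<le> a ?k + sum_list zs"
        using a(2)[rule_format, of ?k] by simp
    qed
    also have "\<dots> \<le> x + inf y z"
      using zs(2,3) a(3) b(3) c(3)
      by (intro add_mono le_infI) (auto intro: SUP_upper SUP_upper2)
    finally show "w \<le> x + inf y z" .
  qed
qed

text \<open>Distributivity truncates both summands at \<open>e\<close>, giving
  \<open>e \<le> inf e x + inf e y\<close>. Rewriting this sum as meet plus join and comparing with
  the chain \<open>[0, e]\<close> turns it into a join.\<close>

lemma e_le_add:
  assumes "e \<le> x + y"
  shows "e = sup (inf e x) (inf e y)"
proof -
  let ?a = "inf e x" and ?b = "inf e y"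
  have "e \<le> inf (e + e) (e + y)"
    using zero_le by (simp add: add_increasing2)
  moreover have "e \<le> inf (x + e) (x + y)"
    using zero_le assms by (simp add: add_increasing)
  ultimately have "e \<le> inf (e + ?b) (x + ?b)"
    by (simp add: add_inf_distrib)
  also have "\<dots> = ?b + ?a"
    using add_inf_distrib[of ?b e x] by (simp add: add.commute)
  finally have "sum_list [0, e] \<le> sum_list [inf ?a ?b, sup ?a ?b]"
    using add_eq_sup_inf[of ?b ?a] by (simp add: ac_simps)
  moreover have "sup ?a ?b \<le> e"
    by simp
  ultimately have "e \<le> sup ?a ?b"
    using topological_lists[of "[0, e]" "[inf ?a ?b, sup ?a ?b]"] zero_le
    by (auto simp: le_infI1 le_supI1 simp del: le_sup_iff)
  then show ?thesis
    by (simp add: order.antisym)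
qed

subsection \<open>The topology of the space of points\<close>

definition open_of :: "'a \<Rightarrow> 'a set" where
  "open_of y = {p \<in> X_points. \<not> y \<le> p}"

lemma openin_X_space_iff: "openin X_space U \<longleftrightarrow> (\<exists>y\<le>e. U = open_of y)"
proof -
  have "open_of y = X_points - X_closed y" for y
    by (auto simp: open_of_def X_closed_def)
  moreover have "X_closed y \<subseteq> X_points" for y :: 'a
    by (auto simp: X_closed_def)
  ultimately show ?thesis
    unfolding openin_closedin_eq topspace_X_space closedin_X_space least_order_unit_eq
    by (metis Diff_Diff_Int Diff_subset inf.absorb_iff2)
qed

lemma closedin_X_space_iff: "closedin X_space C \<longleftrightarrow> (\<exists>y\<le>e. C = X_closed y)"
  unfolding closedin_X_space least_order_unit_eq ..

text \<open>With \<open>openin_X_space_iff\<close> this makes \<open>open_of\<close> an isomorphism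
  from \<open>{..e}\<close> onto the lattice of open sets.\<close>

lemma open_of_subset_iff: "y \<le> e \<Longrightarrow> z \<le> e \<Longrightarrow> open_of y \<subseteq> open_of z \<longleftrightarrow> y \<le> z"
  using le_if_points[of z y] by (auto simp: open_of_def dest: order_trans)

lemma open_of_e: "open_of e = X_points"
  unfolding open_of_def using X_pointsD(1) leD by blast

lemma open_of_Sup: "open_of (Sup A) = (\<Union>y\<in>A. open_of y)"
  by (auto simp: open_of_def Sup_le_iff)

lemma sup_eq_e_iff:
  assumes "y \<le> e" "z \<le> e"
  shows "sup y z = e \<longleftrightarrow> (\<forall>p\<in>X_points. \<not> (y \<le> p \<and> z \<le> p))"
proof
  assume e: "sup y z = e"
  show "\<forall>p\<in>X_points. \<not> (y \<le> p \<and> z \<le> p)"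
  proof (intro ballI notI)
    fix p assume "p \<in> X_points" "y \<le> p \<and> z \<le> p"
    then show False
      using e X_pointsD(1)[of p] le_sup_iff[of y z p] by simp
  qed
next
  assume *: "\<forall>p\<in>X_points. \<not> (y \<le> p \<and> z \<le> p)"
  have "e \<le> sup y z"
    by (rule le_if_points) (use assms * in auto)
  then show "sup y z = e"
    using assms by (simp add: order.antisym)
qed

lemma inf_eq_0_iff:
  assumes "y \<le> e" "z \<le> e"
  shows "inf y z = 0 \<longleftrightarrow> (\<forall>p\<in>X_points. y \<le> p \<or> z \<le> p)"
proof
  assume "inf y z = 0"
  then show "\<forall>p\<in>X_points. y \<le> p \<or> z \<le> p"
    using inf_le_point_iff[OF _ assms] zero_le by simp
next
  assume *: "\<forall>p\<in>X_points. y \<le> p \<or> z \<le> p"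
  have "inf y z \<le> 0"
    by (rule le_if_points) (use assms * zero_le in \<open>auto simp: inf_le_point_iff le_infI1\<close>)
  then show "inf y z = 0"
    by (simp add: order.antisym zero_le)
qed

text \<open>Distinct points are incomparable by maximality, so \<open>X_closed p\<close> is the
  singleton of \<open>p\<close>.\<close>

lemma t1_X_space: "t1_space (X_space :: 'a topology)"
proof -
  have "X_closed p = {p}" "p \<le> e" if p: "p \<in> X_points" for p
  proof -
    have "w = p" if "w \<in> X_closed p" for w
      using that X_pointsD(1) by (intro X_pointsD(2)[OF p]) (auto simp: X_closed_def)
    then show "X_closed p = {p}"
      using p by (auto simp: X_closed_def)
    show "p \<le> e"
      using X_pointsD(1)[OF p] by simp
  qed
  then have "closedin X_space {p}" if "p \<in> X_points" for p :: 'a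
    using that unfolding closedin_X_space_iff by metis
  then show ?thesis
    by (simp add: t1_space_closedin_singleton topspace_X_space)
qed

subsection \<open>Countable bases\<close>

lemma incseq_sum_list:
  fixes f :: "nat \<Rightarrow> 'b \<Rightarrow> 'a"
  assumes "\<And>y. y \<in> set ys \<Longrightarrow> incseq (\<lambda>n. f n y)"
  shows "incseq (\<lambda>n. \<Sum>y\<leftarrow>ys. f n y)"
  unfolding incseq_def
proof (intro allI impI sum_list_mono)
  fix m n :: nat and y assume "m \<le> n" "y \<in> set ys"
  then show "f m y \<le> f n y"
    using incseqD[OF assms] by blast
qed

lemma SUP_sum_list:
  fixes f :: "nat \<Rightarrow> 'b \<Rightarrow> 'a"
  assumes "\<And>y. y \<in> set ys \<Longrightarrow> incseq (\<lambda>n. f n y)"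
  shows "(\<Sum>y\<leftarrow>ys. SUP n. f n y) = (SUP n. \<Sum>y\<leftarrow>ys. f n y)"
  using assms
proof (induction ys)
  case (Cons y ys)
  have "incseq (\<lambda>n. \<Sum>y\<leftarrow>ys. f n y)"
    using Cons.prems by (intro incseq_sum_list) simp
  then show ?case
    using Cons by (simp add: SUP_add)
qed simp

text \<open>An element way below the left-hand side is below some \<open>z n\<close>; this extends
  meet-distributivity from finite joins to increasing sequences.\<close>

lemma inf_SUP_incseq:
  fixes z :: "nat \<Rightarrow> 'a"
  assumes "incseq z"
  shows "inf x (SUP n. z n) = (SUP n. inf x (z n))"
proof (rule order.antisym)
  show "inf x (SUP n. z n) \<le> (SUP n. inf x (z n))"
  proof (rule le_if_way_below_le)
    fix w assume w: "w \<lless> inf x (SUP n. z n)"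
    then obtain n where "w \<le> z n"
      using assms by (rule way_belowD) simp
    then have "w \<le> inf x (z n)"
      using way_below_le[OF w] by simp
    then show "w \<le> (SUP n. inf x (z n))"
      by (rule SUP_upper2[OF UNIV_I])
  qed
  show "(SUP n. inf x (z n)) \<le> inf x (SUP n. z n)"
    by (intro SUP_least inf_mono) (auto intro: SUP_upper)
qed

lemma countably_based_if_interpolating:
  assumes "countable (G :: 'a set)"
    and G: "\<And>w x. w \<lless> x \<Longrightarrow> \<exists>g\<in>G. w \<le> g \<and> g \<le> x"
  shows "countably_based TYPE('a)"
  unfolding countably_based_def
proof (intro exI conjI)
  \<comment> \<open>The interpolating elements need not increase; joins over initial segments do,
    and they stay in a countable set.\<close>
  let ?H = "Sup ` {F. finite F \<and> F \<subseteq> G}"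
  show "countable ?H"
    by (rule countable_image[OF countable_Collect_finite_subset[OF assms(1)]])
  show "sup_dense ?H"
    unfolding sup_dense_def isLub_UNIV_iff
  proof
    fix x :: 'a
    obtain z where z: "\<And>n. z n \<lless> z (Suc n)" "x = (SUP n. z n)"
      using O2[of x] by metis
    have "z n \<lless> x" for n
      using z by (metis way_below_mono SUP_upper UNIV_I order_refl)
    then have "\<exists>g. g \<in> G \<and> z n \<le> g \<and> g \<le> x" for n
      using G by blast
    then obtain g where g: "\<And>n. g n \<in> G \<and> z n \<le> g n \<and> g n \<le> x"
      by metis
    have "x \<le> (SUP n. Sup (g ` {..n}))"
      unfolding z(2)
    proof (rule SUP_least)
      fix n
      have "z n \<le> Sup (g ` {..n})"
        using g by (intro Sup_upper2[of "g n"]) auto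
      then show "z n \<le> (SUP n. Sup (g ` {..n}))"
        by (rule SUP_upper2[OF UNIV_I])
    qed
    moreover have "(SUP n. Sup (g ` {..n})) \<le> x"
      using g by (auto intro!: SUP_least)
    moreover have "incseq (\<lambda>n. Sup (g ` {..n}))"
      by (auto intro!: incseq_SucI Sup_subset_mono)
    moreover have "range (\<lambda>n. Sup (g ` {..n})) \<subseteq> ?H"
      using g by auto
    ultimately show "\<exists>h. incseq h \<and> range h \<subseteq> ?H \<and> x = Sup (range h)"
      by (metis order.antisym)
  qed
qed

text \<open>Elements of \<open>B\<close> below \<open>e\<close> give a base, because
  \<open>open_of\<close> turns the supremum representing \<open>y\<close> into a union.\<close>

lemma second_countable_if_countably_based:
  assumes "countably_based TYPE('a)"
  shows "second_countable (X_space :: 'a topology)"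
proof -
  obtain B :: "'a set" where B: "countable B" "sup_dense B"
    using assms by (auto simp: countably_based_def)
  show ?thesis
    unfolding second_countable_def
  proof (intro exI conjI allI impI ballI)
    show "countable (open_of ` (B \<inter> {..e}))"
      using B by auto
    show "openin X_space V" if "V \<in> open_of ` (B \<inter> {..e})" for V
      using that by (auto simp: openin_X_space_iff)
    fix U :: "'a set" and x assume "openin X_space U \<and> x \<in> U"
    then obtain y where y: "y \<le> e" "U = open_of y" "x \<in> open_of y"
      by (auto simp: openin_X_space_iff)
    obtain z :: "nat \<Rightarrow> 'a" where z: "range z \<subseteq> B" "y = Sup (range z)"
      using B(2) unfolding sup_dense_def isLub_UNIV_iff by blast
    then obtain b where b: "b \<in> range z" "x \<in> open_of b"
      using y(3) unfolding z(2) open_of_Sup by blast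
    have "b \<le> y"
      using b(1) z(2) by (simp add: Sup_upper)
    then have "open_of b \<subseteq> U" "b \<in> B \<inter> {..e}"
      using y b(1) z(1) open_of_subset_iff[of b y] by auto
    then show "\<exists>V\<in>open_of ` (B \<inter> {..e}). x \<in> V \<and> V \<subseteq> U"
      using b(2) by blast
  qed
qed

text \<open>A base of the space generates \<open>{..e}\<close> under suprema. Finite joins of its
  elements approximate each summand of a finite sum, and sums of such joins interpolate the
  way-below relation.\<close>

lemma countably_based_if_second_countable:
  assumes "second_countable (X_space :: 'a topology)"
  shows "countably_based TYPE('a)"
proof -
  obtain \<B> :: "'a set set" where "countable \<B>" and openB: "\<forall>V\<in>\<B>. openin X_space V"
    and base: "\<forall>U x. openin X_space U \<and> x \<in> U \<longrightarrow> (\<exists>V\<in>\<B>. x \<in> V \<and> V \<subseteq> U)"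
    using assms unfolding second_countable_def by blast
  obtain h where h: "\<And>V. V \<in> \<B> \<Longrightarrow> h V \<le> e \<and> V = open_of (h V)"
    using openB unfolding openin_X_space_iff by metis
  define D where "D = h ` \<B>"
  have "countable D" and D_le: "D \<subseteq> {..e}"
    using h \<open>countable \<B>\<close> by (auto simp: D_def)
  have D_sup: "y = Sup {d \<in> D. d \<le> y}" if "y \<le> e" for y
  proof (rule order.antisym)
    show "y \<le> Sup {d \<in> D. d \<le> y}"
    proof (rule le_if_points)
      fix p assume p: "p \<in> X_points" "Sup {d \<in> D. d \<le> y} \<le> p"
      show "y \<le> p"
      proof (rule ccontr)
        assume "\<not> y \<le> p"
        then have "p \<in> open_of y" "openin X_space (open_of y)"
          using p(1) that by (auto simp: open_of_def openin_X_space_iff)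
        then obtain V where V: "V \<in> \<B>" "p \<in> V" "V \<subseteq> open_of y"
          using base by blast
        then have "h V \<in> {d \<in> D. d \<le> y}"
          using h[OF V(1)] open_of_subset_iff[of "h V" y] that by (auto simp: D_def)
        then have "h V \<le> p"
          using p(2) by (meson Sup_upper order_trans)
        then show False
          using V(2) h[OF V(1)] by (auto simp: open_of_def)
      qed
    qed (use that in \<open>auto intro!: Sup_least\<close>)
  qed (auto intro!: Sup_least)
  define D' where "D' = Sup ` {F. finite F \<and> F \<subseteq> D}"
  have "countable D'"
    unfolding D'_def by (rule countable_image[OF countable_Collect_finite_subset[OF \<open>countable D\<close>]])
  \<comment> \<open>The join of the first \<open>n\<close> terms of an enumeration of the generators
    below \<open>y\<close>. The intersection discards the unspecified values of
    \<open>from_nat_into\<close> when there are none.\<close>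
  define f where "f n y = Sup (from_nat_into {d \<in> D. d \<le> y} ` {..<n} \<inter> {d \<in> D. d \<le> y})" for n :: nat and y
  have f_inc: "incseq (\<lambda>n. f n y)" for y
    unfolding f_def by (rule incseq_SucI) (auto intro!: Sup_subset_mono)
  have f_D': "f n y \<in> D'" for n y
    unfolding f_def D'_def by (rule imageI) auto
  have f_sup: "(SUP n. f n y) = y" if "y \<le> e" for y
  proof (rule order.antisym)
    show "(SUP n. f n y) \<le> y"
      unfolding f_def by (auto intro!: SUP_least Sup_least)
    have "d \<le> (SUP n. f n y)" if d: "d \<in> {d \<in> D. d \<le> y}" for d
    proof -
      have "countable {d \<in> D. d \<le> y}"
        by (rule countable_subset[OF _ \<open>countable D\<close>]) auto
      then obtain i where "d = from_nat_into {d \<in> D. d \<le> y} i"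
        using from_nat_into_surj[OF _ d] by metis
      then have "d \<le> f (Suc i) y"
        using d unfolding f_def by (intro Sup_upper) auto
      then show ?thesis
        by (rule SUP_upper2[OF UNIV_I])
    qed
    then have "Sup {d \<in> D. d \<le> y} \<le> (SUP n. f n y)"
      by (rule Sup_least)
    then show "y \<le> (SUP n. f n y)"
      using D_sup[OF that] by simp
  qed
  show ?thesis
  proof (rule countably_based_if_interpolating)
    show "countable (sum_list ` lists D')"
      using \<open>countable D'\<close> by (intro countable_image countable_lists)
    fix w x :: 'a assume "w \<lless> x"
    obtain z where z: "\<And>n. z n \<lless> z (Suc n)" "x = (SUP n. z n)"
      using O2[of x] by metis
    have "incseq z"
      by (rule incseq_SucI) (rule way_below_le[OF z(1)])
    then obtain n where n: "w \<le> z n"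
      using way_belowD[OF \<open>w \<lless> x\<close>] z(2) by (metis order_refl)
    have "z (Suc n) \<lless> x"
      by (rule way_below_mono[OF order_refl z(1)]) (simp add: z(2) SUP_upper)
    obtain y y' where y: "incseq y" "\<forall>n. set (y' n) \<subseteq> {..e} \<and> y n = sum_list (y' n)" "x = (SUP n. y n)"
      by (rule dense_below)
    obtain m where m: "z (Suc n) \<le> y m"
      using way_belowD[OF \<open>z (Suc n) \<lless> x\<close> y(1)] y(3) by auto
    have "(\<Sum>u\<leftarrow>y' m. SUP k. f k u) = y m"
      using y(2) f_sup by (simp add: subset_iff cong: map_cong)
    then have y_eq: "y m = (SUP k. \<Sum>u\<leftarrow>y' m. f k u)"
      using SUP_sum_list[of "y' m" f] f_inc by simp
    \<comment> \<open>Interposing \<open>z n\<close> and \<open>z (Suc n)\<close> keeps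
      \<open>w\<close> way below the finite sum \<open>y m\<close>, which can thus be approximated
      in turn.\<close>
    have "w \<lless> y m"
      by (rule way_below_mono[OF n z(1) m])
    moreover have "incseq (\<lambda>k. \<Sum>u\<leftarrow>y' m. f k u)"
      by (intro incseq_sum_list f_inc)
    ultimately obtain k where "w \<le> (\<Sum>u\<leftarrow>y' m. f k u)"
      by (rule way_belowD) (simp add: y_eq)
    moreover have "(\<Sum>u\<leftarrow>y' m. f k u) \<le> x"
      using y_eq y(3) by (metis SUP_upper UNIV_I order_trans)
    moreover have "(\<Sum>u\<leftarrow>y' m. f k u) \<in> sum_list ` lists D'"
      using f_D' by (intro imageI) auto
    ultimately show "\<exists>g\<in>sum_list ` lists D'. w \<le> g \<and> g \<le> x"
      by blast
  qed
qed

subsection \<open>Compactness\<close>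

text \<open>Compactness puts \<open>u\<close> below some \<open>n\<close>-fold multiple of
  \<open>e\<close>. If \<open>z\<close> increases past \<open>e\<close>, the \<open>n\<close>-fold
  multiples of \<open>inf e (z k)\<close> increase past \<open>u\<close>, so one of them dominates
  \<open>u\<close> and hence \<open>e\<close>; then the multiple is cancelled.\<close>

lemma compact_e_if_compact_order_unit:
  fixes u :: 'a
  assumes "order_unit u" "compact_element u"
  shows "compact_element e"
proof -
  have "u \<le> infty_times e"
    using order_unit_e by (simp add: order_unit_def)
  then obtain n where n: "u \<le> sum_list (replicate n e)"
    using assms(2) incseq_replicate[of e] way_belowD[of u u] unfolding infty_times_eq compact_element_def
    by (metis (no_types, lifting))
  show ?thesis
    unfolding compact_element_def way_below_def isLub_UNIV_iff
  proof (intro allI impI)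
    fix z s assume z: "incseq z" "s = Sup (range z)" "e \<le> s"
    have inc: "incseq (\<lambda>k. inf e (z k))"
      using z(1) by (auto simp: incseq_def intro: le_infI2)
    have "(SUP k. inf e (z k)) = e"
      using inf_SUP_incseq[OF z(1), of e] z by (simp add: inf_absorb1)
    \<comment> \<open>The list of dummy indices expresses the \<open>n\<close>-fold multiple as a
      sum over a list, so that \<open>SUP_sum_list\<close> applies.\<close>
    then have "sum_list (replicate n e) = (\<Sum>i\<leftarrow>replicate n (0::nat). SUP k. inf e (z k))"
      by simp
    also have "\<dots> = (SUP k. \<Sum>i\<leftarrow>replicate n (0::nat). inf e (z k))"
      by (rule SUP_sum_list) (rule inc)
    finally have sup: "u \<le> (SUP k. sum_list (replicate n (inf e (z k))))"
      using n by simp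
    have "incseq (\<lambda>k. \<Sum>i\<leftarrow>replicate n (0::nat). inf e (z k))"
      by (intro incseq_sum_list inc)
    then have "incseq (\<lambda>k. sum_list (replicate n (inf e (z k))))"
      by simp
    then obtain k where "u \<le> sum_list (replicate n (inf e (z k)))"
      using way_belowD[OF assms(2)[unfolded compact_element_def] _ sup] by blast
    then have "e \<le> sum_list (replicate n (inf e (z k)))"
      using e_le_order_unit[OF assms(1)] by (rule order_trans[rotated])
    then have "e \<le> inf e (z k)"
      by (rule le_if_le_replicate[rotated 2]) auto
    then show "\<exists>k. e \<le> z k"
      by auto
  qed
qed

text \<open>Under \<open>open_of\<close>, an increasing sequence with supremum \<open>e\<close> is
  an increasing countable open cover, and compactness of \<open>e\<close> says that some member is
  the whole space.\<close>

lemma countably_compact_iff_compact_e: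
  "countably_compact_space (X_space :: 'a topology) \<longleftrightarrow> compact_element e"
proof
  assume cc: "countably_compact_space (X_space :: 'a topology)"
  show "compact_element e"
    unfolding compact_element_def way_below_def isLub_UNIV_iff
  proof (intro allI impI)
    fix z :: "nat \<Rightarrow> 'a" and s assume z: "incseq z" "s = Sup (range z)" "e \<le> s"
    let ?U = "\<lambda>k. open_of (inf e (z k))"
    have "open_of (SUP k. inf e (z k)) = X_points"
      using inf_SUP_incseq[OF z(1), of e] z by (simp add: inf_absorb1 open_of_e)
    then have "topspace X_space \<subseteq> \<Union>(range ?U)"
      by (auto simp: topspace_X_space open_of_Sup)
    moreover have "\<forall>V\<in>range ?U. openin X_space V"
      unfolding openin_X_space_iff using inf_le1 by blast
    ultimately obtain \<F> where "\<F> \<subseteq> range ?U" "finite \<F>" "topspace X_space \<subseteq> \<Union>\<F>"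
      using cc unfolding countably_compact_space_def by (metis countable_image countableI_type)
    then obtain K where K: "finite K" "topspace X_space \<subseteq> \<Union>(?U ` K)"
      by (metis finite_subset_image)
    \<comment> \<open>Inserting 0 keeps \<open>Max\<close> meaningful when \<open>K\<close> is
      empty.\<close>
    define m where "m = Max (insert 0 K)"
    have "e \<le> inf e (z m)"
    proof (rule le_if_points)
      fix p assume p: "p \<in> X_points" "inf e (z m) \<le> p"
      then obtain k where k: "k \<in> K" "\<not> inf e (z k) \<le> p"
        using K(2) by (auto simp: topspace_X_space open_of_def)
      have "inf e (z k) \<le> inf e (z m)"
        using incseqD[OF z(1), of k m] K(1) k(1) by (intro inf_mono) (auto simp: m_def)
      then show "e \<le> p"
        using k(2) p(2) order_trans by blast
    qed auto
    then show "\<exists>k. e \<le> z k"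
      by auto
  qed
next
  assume e: "compact_element e"
  show "countably_compact_space (X_space :: 'a topology)"
    unfolding countably_compact_space_def topspace_X_space
  proof (intro allI impI)
    fix \<U> :: "'a set set"
    assume \<U>: "countable \<U>" "\<forall>U\<in>\<U>. openin X_space U" "X_points \<subseteq> \<Union>\<U>"
    show "\<exists>\<F>\<subseteq>\<U>. finite \<F> \<and> X_points \<subseteq> \<Union>\<F>"
    proof (cases "\<U> = {}")
      case True
      then show ?thesis
        using \<U>(3) by auto
    next
      case False
      then obtain V :: "nat \<Rightarrow> 'a set" where V: "range V = \<U>"
        using range_from_nat_into[OF _ \<U>(1)] by blast
      have "\<exists>y\<le>e. V n = open_of y" for n :: nat
        using \<U>(2) V unfolding openin_X_space_iff by blast
      then obtain y where y: "\<And>n. y n \<le> e \<and> V n = open_of (y n)"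
        by metis
      \<comment> \<open>Partial joins turn the enumerated cover into an increasing sequence.\<close>
      let ?z = "\<lambda>n. SUP i\<in>{..n}. y i"
      have "e \<le> (SUP n. ?z n)"
      proof (rule le_if_points)
        fix p assume p: "p \<in> X_points" "(SUP n. ?z n) \<le> p"
        then obtain n where "p \<in> open_of (y n)"
          using \<U>(3) V y by blast
        moreover have "y n \<le> (SUP n. ?z n)"
          by (rule SUP_upper2[of n]) (auto intro: SUP_upper)
        ultimately show "e \<le> p"
          using p(2) by (auto simp: open_of_def)
      qed (use y in \<open>auto intro!: SUP_least\<close>)
      moreover have "incseq ?z"
        by (auto intro!: incseq_SucI Sup_subset_mono)
      ultimately obtain n where "e \<le> ?z n"
        using way_belowD[OF e[unfolded compact_element_def], of ?z] by blast
      moreover have "?z n \<le> e"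
        using y by (auto intro: SUP_least)
      ultimately have "X_points = open_of (?z n)"
        using open_of_e by (metis order.antisym)
      then have "X_points = \<Union>(V ` {..n})"
        using y by (simp add: open_of_Sup)
      then show ?thesis
        using V by (intro exI[of _ "V ` {..n}"]) auto
    qed
  qed
qed

lemma compact_X_space:
  assumes "countably_based TYPE('a)" "compact_element e"
  shows "compact_space (X_space :: 'a topology)"
  unfolding compact_space
proof (intro allI impI)
  fix \<U> :: "'a set set"
  assume \<U>: "(\<forall>U\<in>\<U>. openin X_space U) \<and> \<Union>\<U> = topspace X_space"
  have "Lindelof_space (X_space :: 'a topology)"
    by (intro second_countable_imp_Lindelof_space second_countable_if_countably_based assms)
  then obtain \<V> where \<V>: "countable \<V>" "\<V> \<subseteq> \<U>" "\<Union>\<V> = topspace X_space"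
    using \<U> unfolding Lindelof_space_def by metis
  then obtain \<F> where "\<F> \<subseteq> \<V>" "finite \<F>" "topspace X_space \<subseteq> \<Union>\<F>"
    using assms(2) \<U> unfolding countably_compact_iff_compact_e[symmetric] countably_compact_space_def
    by (metis order_refl subset_iff)
  then show "\<exists>\<F>. finite \<F> \<and> \<F> \<subseteq> \<U> \<and> \<Union>\<F> = topspace X_space"
    using \<U> \<V> by (intro exI[of _ \<F>]) blast
qed

subsection \<open>Normality\<close>

text \<open>The facts \<open>1\<close>, \<open>2\<close> and \<open>3\<close> translate disjoint
  closed sets, closed sets inside open sets, and disjoint open sets into equations in
  \<open>{..e}\<close>.\<close>

lemma normal_X_space_iff:
  "normal_space (X_space :: 'a topology) \<longleftrightarrow>
    (\<forall>y\<le>e. \<forall>z\<le>e. sup y z = e \<longrightarrow>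
      (\<exists>s\<le>e. \<exists>t\<le>e. sup y s = e \<and> sup z t = e \<and> inf s t = 0))"
proof -
  have 1: "disjnt (X_closed y) (X_closed z) \<longleftrightarrow> sup y z = e" if "y \<le> e" "z \<le> e" for y z
    using that by (auto simp: disjnt_iff X_closed_def sup_eq_e_iff)
  have 2: "X_closed y \<subseteq> open_of s \<longleftrightarrow> sup y s = e" if "y \<le> e" "s \<le> e" for y s
    using that by (auto simp: subset_iff X_closed_def open_of_def sup_eq_e_iff)
  have 3: "disjnt (open_of s) (open_of t) \<longleftrightarrow> inf s t = 0" if "s \<le> e" "t \<le> e" for s t
    using that by (auto simp: disjnt_iff open_of_def inf_eq_0_iff)
  have all: "(\<forall>S. closedin X_space S \<longrightarrow> P S) \<longleftrightarrow> (\<forall>y\<le>e. P (X_closed y))" for P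
    by (auto simp: closedin_X_space_iff)
  have ex: "(\<exists>U. openin X_space U \<and> P U) \<longleftrightarrow> (\<exists>s\<le>e. P (open_of s))" for P
    by (auto simp: openin_X_space_iff)
  have "normal_space (X_space :: 'a topology) \<longleftrightarrow>
    (\<forall>S. closedin X_space S \<longrightarrow> (\<forall>T. closedin X_space T \<longrightarrow> disjnt S T \<longrightarrow>
      (\<exists>U. openin X_space U \<and> (\<exists>V. openin (X_space :: 'a topology) V \<and>
        S \<subseteq> U \<and> T \<subseteq> V \<and> disjnt U V))))"
    unfolding normal_space_def by (simp only: ex_simps all_simps conj_assoc imp_conjL)
  then show ?thesis
    unfolding all ex by (simp add: 1 2 3 cong: conj_cong)
qed

text \<open>The order unit is \<open>e\<close>: by \<open>e_le_add\<close>, a sum above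
  \<open>e\<close> gives a join equal to \<open>e\<close> after truncation.\<close>

lemma normal_cu_semigroup_if_normal_space:
  assumes "normal_space (X_space :: 'a topology)"
  shows "normal_cu_semigroup TYPE('a)"
  unfolding normal_cu_semigroup_def
proof (intro conjI)
  show "inf_semilattice_ordered TYPE('a)"
    by (simp add: inf_semilattice_ordered_def add_inf_distrib)
  have "\<exists>s t. e \<le> x + s \<and> e \<le> y + t \<and> inf s t = 0" if "e \<le> x + y" for x y
  proof -
    have "sup (inf e x) (inf e y) = e"
      using e_le_add[OF that] by simp
    then obtain s t where st: "sup (inf e x) s = e" "sup (inf e y) t = e" "inf s t = 0"
      using assms unfolding normal_X_space_iff by (metis inf_le1)
    have "sup (inf e x) s \<le> x + s" "sup (inf e y) t \<le> y + t"
      by (rule order_trans[OF sup_le_add], simp add: add_right_mono)+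
    then show ?thesis
      using st by auto
  qed
  then show "\<exists>z::'a. order_unit z \<and>
      (\<forall>x y. z \<le> x + y \<longrightarrow> (\<exists>s t. z \<le> x + s \<and> z \<le> y + t \<and> inf s t = 0))"
    using order_unit_e by blast
qed (rule cu)

text \<open>The given order unit \<open>z\<close> may exceed \<open>e\<close>, so \<open>y1\<close>
  and \<open>y2\<close> are replaced by their infinite multiples, whose sum dominates everything.
  Truncating at \<open>e\<close> recovers \<open>y1\<close> and \<open>y2\<close>.\<close>

lemma normal_space_if_normal_cu_semigroup:
  assumes "normal_cu_semigroup TYPE('a)"
  shows "normal_space (X_space :: 'a topology)"
  unfolding normal_X_space_iff
proof (intro allI impI)
  fix y1 y2 assume y: "y1 \<le> e" "y2 \<le> e" "sup y1 y2 = e"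
  obtain z :: 'a where z: "order_unit z"
    "\<And>x y. z \<le> x + y \<Longrightarrow> \<exists>s t. z \<le> x + s \<and> z \<le> y + t \<and> inf s t = 0"
    using assms unfolding normal_cu_semigroup_def by metis
  have le: "inf e (infty_times y) = y" if "y \<le> e" for y
    using le_if_le_infty_times[of "inf e (infty_times y)" y] that le_infty_times[of y]
    by (intro order.antisym) (auto intro: le_infI1)
  have "infty_times e \<le> infty_times y1 + infty_times y2"
  proof (rule infty_times_le)
    show "idempotent (infty_times y1 + infty_times y2)"
      using idempotent_infty_times[of y1] idempotent_infty_times[of y2]
      unfolding idempotent_def by (metis add.assoc add.commute)
    have "e \<le> y1 + y2"
      using sup_le_add[of y1 y2] y(3) by simp
    then show "e \<le> infty_times y1 + infty_times y2"
      by (rule order_trans) (intro add_mono le_infty_times)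
  qed
  then have "z \<le> infty_times y1 + infty_times y2"
    using order_unit_e order_trans unfolding order_unit_def by blast
  then obtain s t where st: "z \<le> infty_times y1 + s" "z \<le> infty_times y2 + t" "inf s t = 0"
    using z(2) by blast
  have "e \<le> z"
    by (rule e_le_order_unit[OF z(1)])
  then have "sup y1 (inf e s) = e" "sup y2 (inf e t) = e"
    using e_le_add[OF order_trans[OF _ st(1)]] e_le_add[OF order_trans[OF _ st(2)]] le y(1,2) by simp_all
  moreover have "inf (inf e s) (inf e t) = 0"
    using st(3) zero_le by (metis inf.assoc inf.commute inf.left_idem inf_absorb2 inf_bot_right)
  ultimately show "\<exists>s\<le>e. \<exists>t\<le>e. sup y1 s = e \<and> sup y2 t = e \<and> inf s t = 0"
    by (metis inf_le1)
qed

text \<open>Compactness of \<open>e\<close> allows shrinking \<open>y1\<close> to some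
  \<open>w n \<lless> y1\<close> that still joins with \<open>y2\<close> to \<open>e\<close>. Then
  (O5) gives an almost complement \<open>c\<close> of \<open>y1\<close>, disjoint from
  \<open>w n\<close>.\<close>

lemma normal_space_if_O5:
  assumes "compact_element e" "O5 TYPE('a)"
  shows "normal_space (X_space :: 'a topology)"
  unfolding normal_X_space_iff
proof (intro allI impI)
  fix y1 y2 assume y: "y1 \<le> e" "y2 \<le> e" "sup y1 y2 = e"
  obtain w where w: "\<And>n. w n \<lless> w (Suc n)" "y1 = (SUP n. w n)"
    using O2[of y1] by metis
  have w_le: "w n \<lless> y1" for n
    by (rule way_below_mono[OF order_refl w(1)]) (simp add: w(2) SUP_upper)
  have "incseq w"
    by (rule incseq_SucI) (rule way_below_le[OF w(1)])
  then have "incseq (\<lambda>n. sup (w n) y2)"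
    by (auto simp: incseq_def intro: le_supI1)
  moreover have "e \<le> (SUP n. sup (w n) y2)"
    unfolding y(3)[symmetric]
  proof (rule sup_least)
    show "y1 \<le> (SUP n. sup (w n) y2)"
      unfolding w(2) by (rule SUP_mono) (use sup_ge1 in blast)
    show "y2 \<le> (SUP n. sup (w n) y2)"
      by (rule SUP_upper2[OF UNIV_I]) simp
  qed
  ultimately obtain n where n: "e \<le> sup (w n) y2"
    by (rule way_belowD[OF assms(1)[unfolded compact_element_def]])
  \<comment> \<open>The second summand in (O5) is taken to be 0, which is way below itself.\<close>
  have "y1 + 0 \<le> e" "0 \<lless> (0::'a)"
    using y(1) zero_le by (auto simp: way_below_def)
  then obtain c where c: "w n + c \<le> e" "e \<le> y1 + c"
    using assms(2) w_le unfolding O5_def by metis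
  have "c \<le> e" "w n \<le> e"
    using c(1) zero_le by (metis add_increasing add_increasing2 order_refl order_trans)+
  moreover have "sup y1 c = e"
    using e_le_add[OF c(2)] y(1) \<open>c \<le> e\<close> by (simp add: inf_absorb2)
  moreover have "sup y2 (w n) = e"
    using n y(2) \<open>w n \<le> e\<close> by (simp add: order.antisym sup_commute)
  moreover have "inf c (w n) = 0"
  proof -
    let ?i = "inf c (w n)" and ?s = "sup c (w n)"
    \<comment> \<open>Comparing first entries with the chain \<open>[0, e]\<close> forces the meet
      below 0: a sum below \<open>e\<close> has disjoint summands.\<close>
    have "sum_list [?i, ?s] \<le> sum_list [0, e]"
      using c(1) add_eq_sup_inf[of c "w n"] by (simp add: ac_simps)
    moreover have "?i \<le> e" "?s \<le> e" "?i \<le> ?s"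
      using \<open>c \<le> e\<close> \<open>w n \<le> e\<close> by (auto intro: le_infI1 le_supI1)
    ultimately have "?i \<le> 0"
      using topological_lists[of "[?i, ?s]" "[0, e]"] zero_le by simp
    then show ?thesis
      by (simp add: order.antisym zero_le)
  qed
  ultimately show "\<exists>s\<le>e. \<exists>t\<le>e. sup y1 s = e \<and> sup y2 t = e \<and> inf s t = 0"
    by blast
qed

end

section \<open>Assembly of the equivalences and the two metrizability claims\<close>

theorem proposition5p7:
  assumes "lsc_like TYPE('a::{ordered_comm_monoid_add, complete_lattice, distrib_lattice})"
  shows
    "(second_countable (X_space :: 'a topology) \<longleftrightarrow> countably_based TYPE('a)) \<and>
     (countably_compact_space (X_space :: 'a topology) \<longleftrightarrow>
        (\<exists>u::'a. order_unit u \<and> compact_element u)) \<and>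
     (normal_space (X_space :: 'a topology) \<longleftrightarrow> normal_cu_semigroup TYPE('a)) \<and>
     (countably_based TYPE('a) \<and> normal_cu_semigroup TYPE('a) \<longrightarrow>
        metrizable_space (X_space :: 'a topology)) \<and>
     (countably_based TYPE('a) \<and> (\<exists>u::'a. order_unit u \<and> compact_element u) \<and> O5 TYPE('a) \<longrightarrow>
        compact_space (X_space :: 'a topology) \<and> metrizable_space (X_space :: 'a topology))"
proof -
  obtain e :: 'a where "topological_subset {..e}" "sup_dense (sum_list ` lists {..e})"
    using assms unfolding lsc_like_def C2_def by blast
  then interpret lsc_like_cu e
    using assms by unfold_locales
  have base: "second_countable (X_space :: 'a topology) \<longleftrightarrow> countably_based TYPE('a)"
    using second_countable_if_countably_based countably_based_if_second_countable by blast
  have compact: "(\<exists>u::'a. order_unit u \<and> compact_element u) \<longleftrightarrow> compact_element e"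
    using order_unit_e compact_e_if_compact_order_unit by blast
  have normal: "normal_space (X_space :: 'a topology) \<longleftrightarrow> normal_cu_semigroup TYPE('a)"
    using normal_cu_semigroup_if_normal_space normal_space_if_normal_cu_semigroup by blast
  have metrizable: "metrizable_space (X_space :: 'a topology)"
    if "countably_based TYPE('a)" "normal_space (X_space :: 'a topology)"
    using Urysohn_metrization[OF _ that(2) t1_X_space] base that(1) by blast
  show ?thesis
    unfolding compact using base countably_compact_iff_compact_e normal metrizable compact_X_space
      normal_space_if_O5 by blast
qed

end
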